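(* Let $K$ be a (nonempty) compact set in a Hilbert space $X$, let $\gamma\in(0,1]$, and let $\{f_n\}_{n\ge 1}\subset K$ be any sequence generated by the weak greedy algorithm with parameter $\gamma$ applied to $K$, with associated error $\sigma_n(K)_X$. Then for every $n\ge 1$, $$\sigma_n(K)_X\le \gamma^{-1}(n!\,V_n)^{\frac1n}\,\varepsilon_n(\mathrm{co}(K))_X .$$
   Context: For a subspace $U\subset X$ and $f\in X$, $\mathrm{dist}(f,U)=\inf_{g\in U}\|f-g\|_X$. Weak greedy algorithm with parameter $\gamma\in(0,1]$: set $X_0=\{0\}$; for $n=1,2,\dots$ select any $f_n\in K$ with $\mathrm{dist}(f_n,X_{n-1})\ge\gamma\max_{f\in K}\mathrm{dist}(f,X_{n-1})$ and set $X_n=\mathrm{span}\{f_1,\dots,f_n\}$. The iterates need not be unique. The error of the algorithm is $\sigma_n(K)=\sigma_n(K)_X:=\sup_{f\in K}\mathrm{dist}(f,X_n)$. Symmetric convex hull: $\mathrm{co}(K)=\overline{\{\sum_i c_ig_i:\ \sum_i|c_i|\le1,\ g_i\in K \text{ for each } i\}}$ (closure in $X$). (Dyadic) entropy numbers: $\varepsilon_n(A)_X=\inf\{\varepsilon>0:\ A \text{ is covered by } 2^n \text{ balls of } X \text{ of radius } \varepsilon\}$. $V_n=\pi^{n/2}/\Gamma(\frac n2+1)$ is the volume of the Euclidean unit ball in $\mathbb{R}^n$. *)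

theory Defs
  imports "HOL-Analysis.Analysis"
begin

text \<open>
  The distance from a point to a subspace is the library's \<^const>\<open>infdist\<close>. Sequences of greedy
  selections \<open>f\<close> are indexed from 1; the value \<open>f 0\<close> is never used.
\<close>

definition greedy_space :: "(nat \<Rightarrow> 'a::real_normed_vector) \<Rightarrow> nat \<Rightarrow> 'a set" where
  "greedy_space f n = span (f ` {1..n})"

definition greedy_error :: "'a::real_normed_vector set \<Rightarrow> (nat \<Rightarrow> 'a) \<Rightarrow> nat \<Rightarrow> real" where
  "greedy_error K f n = (SUP g\<in>K. infdist g (greedy_space f n))"

text \<open>
  The supremum in the selection rule is a maximum when \<open>K\<close> is compact and nonempty.
\<close>

definition weak_greedy :: "real \<Rightarrow> 'a::real_normed_vector set \<Rightarrow> (nat \<Rightarrow> 'a) \<Rightarrow> bool" where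
  "weak_greedy \<gamma> K f \<longleftrightarrow>
     (\<forall>n\<ge>1. f n \<in> K \<and>
        infdist (f n) (greedy_space f (n - 1))
          \<ge> \<gamma> * (SUP g\<in>K. infdist g (greedy_space f (n - 1))))"

definition sym_convex_hull :: "'a::real_normed_vector set \<Rightarrow> 'a set" where
  "sym_convex_hull K =
     closure {(\<Sum>i<m. c i *\<^sub>R g i) | (m::nat) (c::nat \<Rightarrow> real) (g::nat \<Rightarrow> 'a).
                (\<Sum>i<m. \<bar>c i\<bar>) \<le> 1 \<and> (\<forall>i<m. g i \<in> K)}"

text \<open>
  The \<open>2 ^ n\<close> centres need not be distinct. Taking closed rather than open balls does not affect
  the infimum. The real-valued infimum is meaningful for bounded \<open>A\<close>, where the set of
  admissible radii is nonempty.
\<close>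

definition entropy_number :: "nat \<Rightarrow> 'a::metric_space set \<Rightarrow> real" where
  "entropy_number n A =
     Inf {\<epsilon>. \<epsilon> > 0 \<and> (\<exists>c::nat \<Rightarrow> 'a. A \<subseteq> (\<Union>i<2 ^ n. cball (c i) \<epsilon>))}"

end

(* Weak greedy selections have distance at least \<gamma> \<sigma>_n from the span of their predecessors for
   indices up to n, since the errors decrease. In Gram-Schmidt coordinates the map
   x \<mapsto> sum x_k f_k is therefore triangular with diagonal entries at least \<gamma> \<sigma>_n, so
   co(K) contains the image of the cross-polytope, of volume at least (2 \<gamma> \<sigma>_n)^n / n!. By
   Bessel's inequality a ball of X of radius \<epsilon> covers at most volume V_n \<epsilon>^n of it, and
   2^n balls give (\<gamma> \<sigma>_n)^n \<le> n! V_n \<epsilon>^n. The volumes are computed in parameter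
   space with the product measure on {1..n}, so that n need not be encoded as a type. *)
theory Submission
  imports Defs
begin

section \<open>Lebesgue measure on finite products: triangular maps and cross-polytopes\<close>

text \<open>Induction on the largest index \<open>b\<close>. Output \<open>b\<close> depends on
  coordinate \<open>b\<close> alone, so integrating that coordinate outermost reduces it to a
  one-dimensional affine substitution. Every other output sees coordinate \<open>b\<close> only as a
  translation, which is why \<open>v\<close> must be arbitrary in the induction.\<close>

lemma nn_integral_PiM_lborel_triangular_affine:
  fixes a :: "'i::linorder \<Rightarrow> 'i \<Rightarrow> real" and v :: "'i \<Rightarrow> real"
  assumes "finite I"
    and "h \<in> borel_measurable (Pi\<^sub>M I (\<lambda>_. lborel))"
    and "\<And>j. j \<in> I \<Longrightarrow> a j j \<noteq> 0"
    and "\<And>j k. j \<in> I \<Longrightarrow> k \<in> I \<Longrightarrow> k < j \<Longrightarrow> a j k = 0"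
  shows "(\<integral>\<^sup>+ x. h x \<partial>Pi\<^sub>M I (\<lambda>_. lborel)) =
    ennreal (\<Prod>j\<in>I. \<bar>a j j\<bar>) *
      (\<integral>\<^sup>+ x. h (\<lambda>j\<in>I. v j + (\<Sum>k\<in>I. a j k * x k)) \<partial>Pi\<^sub>M I (\<lambda>_. lborel))"
  using assms
proof (induction I arbitrary: h v rule: finite_linorder_max_induct)
  case empty
  show ?case by (simp add: PiM_empty restrict_def nn_integral_count_space_finite)
next
  case (insert b A h v)
  interpret product_sigma_finite "\<lambda>_. lborel :: real measure"
    by standard
  let ?M = "\<lambda>A. Pi\<^sub>M A (\<lambda>_::'i. lborel :: real measure)"
  have [simp]: "finite A" "b \<notin> A" using insert.hyps by auto
  note h[measurable] = insert.prems(1)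
  have zero: "a b k = 0" if "k \<in> A" for k using insert.prems(3)[of b k] insert.hyps that by auto
  have upd_meas[measurable]: "(\<lambda>x. x(b := y)) \<in> measurable (?M A) (?M (insert b A))" for y
    by measurable
  define T where "T = (\<lambda>x. \<lambda>j\<in>insert b A. v j + (\<Sum>k\<in>insert b A. a j k * x k))"
  define g where "g = (\<lambda>y. \<integral>\<^sup>+ x. h (x(b := y)) \<partial>?M A)"
  have g_meas[measurable]: "g \<in> borel_measurable borel"
  proof -
    interpret A: finite_product_sigma_finite "\<lambda>_. lborel :: real measure" A by standard simp
    have "(\<lambda>(y, x). h (x(b := y))) \<in> borel_measurable (borel \<Otimes>\<^sub>M ?M A)"
      by measurable
    thus ?thesis unfolding g_def by (rule A.borel_measurable_nn_integral)
  qed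
  have T_meas[measurable]: "T \<in> measurable (?M (insert b A)) (?M (insert b A))"
    unfolding T_def by measurable
  have split: "T (x(b := y)) =
      (\<lambda>j\<in>A. (v j + a j b * y) + (\<Sum>k\<in>A. a j k * x k))(b := v b + a b b * y)" for x y
  proof -
    have "(\<Sum>k\<in>A. a j k * (if k = b then y else x k)) = (\<Sum>k\<in>A. a j k * x k)" for j
      by (intro sum.cong) auto
    moreover have "(\<Sum>k\<in>A. a b k * x k) = 0" using zero by simp
    ultimately show ?thesis by (auto simp: T_def fun_eq_iff)
  qed
  have "(\<integral>\<^sup>+ x. h x \<partial>?M (insert b A)) = (\<integral>\<^sup>+ y. g y \<partial>lborel)"
    unfolding g_def by (rule product_nn_integral_insert_rev) auto
  also have "\<dots> = ennreal \<bar>a b b\<bar> * (\<integral>\<^sup>+ y. g (v b + a b b * y) \<partial>lborel)"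
    using insert.prems(2) by (intro nn_integral_real_affine) auto
  \<comment> \<open>For fixed \<open>y\<close> the induction hypothesis is applied with coordinate
    \<open>b\<close> of the integrand frozen at \<open>v b + a b b * y\<close> and with the new
    translation \<open>v j + a j b * y\<close>.\<close>
  also have "(\<lambda>y. g (v b + a b b * y)) = (\<lambda>y. ennreal (\<Prod>j\<in>A. \<bar>a j j\<bar>) *
      (\<integral>\<^sup>+ x. h (T (x(b := y))) \<partial>?M A))"
    unfolding g_def split
    by (intro ext insert.IH measurable_compose[OF upd_meas h]) (use insert.prems(2,3) in auto)
  also have "(\<integral>\<^sup>+ y. \<dots> y \<partial>lborel) =
      ennreal (\<Prod>j\<in>A. \<bar>a j j\<bar>) * (\<integral>\<^sup>+ y. (\<integral>\<^sup>+ x. h (T (x(b := y))) \<partial>?M A) \<partial>lborel)"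
  proof (rule nn_integral_cmult)
    interpret A: finite_product_sigma_finite "\<lambda>_. lborel :: real measure" A by standard simp
    have "(\<lambda>(y, x). h (T (x(b := y)))) \<in> borel_measurable (lborel \<Otimes>\<^sub>M ?M A)"
      by measurable
    thus "(\<lambda>y. \<integral>\<^sup>+ x. h (T (x(b := y))) \<partial>?M A) \<in> borel_measurable lborel"
      by (rule A.borel_measurable_nn_integral)
  qed
  also have "(\<integral>\<^sup>+ y. (\<integral>\<^sup>+ x. h (T (x(b := y))) \<partial>?M A) \<partial>lborel) = (\<integral>\<^sup>+ x. h (T x) \<partial>?M (insert b A))"
    by (rule product_nn_integral_insert_rev[symmetric]) auto
  also have "ennreal \<bar>a b b\<bar> * (ennreal (\<Prod>j\<in>A. \<bar>a j j\<bar>) * I) =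
      ennreal (\<Prod>j\<in>insert b A. \<bar>a j j\<bar>) * I" for I
    by (simp add: ennreal_mult prod_nonneg mult.assoc)
  finally show ?case unfolding T_def .
qed

text \<open>This is the integral over the slices of a cross-polytope: up to a constant, the slice at
  height \<open>y\<close> has volume \<open>(t - \<bar>y\<bar>) ^ m\<close>. The indicator is
  essential, since even powers do not vanish for \<open>\<bar>y\<bar> > t\<close>.\<close>

lemma nn_integral_diff_abs_power:
  assumes "0 \<le> (t::real)"
  shows "(\<integral>\<^sup>+ y. ennreal ((t - \<bar>y\<bar>) ^ m) * indicator {-t..t} y \<partial>lborel)
    = ennreal (2 * t ^ Suc m / Suc m)"
proof -
  \<comment> \<open>Splitting at 0 removes the absolute value. The two halves overlap only at
    \<open>y = 0\<close>, a null set.\<close>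
  have "(\<integral>\<^sup>+ y. ennreal ((t - \<bar>y\<bar>) ^ m) * indicator {-t..t} y \<partial>lborel) =
      (\<integral>\<^sup>+ y. ennreal ((t + y) ^ m) * indicator {-t..0} y +
             ennreal ((t - y) ^ m) * indicator {0..t} y \<partial>lborel)"
    using AE_lborel_singleton[of 0]
    by (intro nn_integral_cong_AE, eventually_elim) (auto simp: indicator_def)
  also have "\<dots> = (\<integral>\<^sup>+ y. ennreal ((t + y) ^ m) * indicator {-t..0} y \<partial>lborel) +
      (\<integral>\<^sup>+ y. ennreal ((t - y) ^ m) * indicator {0..t} y \<partial>lborel)"
    by (rule nn_integral_add) auto
  also have "(\<integral>\<^sup>+ y. ennreal ((t + y) ^ m) * indicator {-t..0} y \<partial>lborel) =
      ennreal ((t + 0) ^ Suc m / Suc m - (t + - t) ^ Suc m / Suc m)"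
  proof (rule nn_integral_FTC_Icc)
    show "((\<lambda>y. (t + y) ^ Suc m / Suc m) has_real_derivative (t + y) ^ m) (at y)" for y
      by (rule derivative_eq_intros refl | simp del: of_nat_Suc power_Suc)+
  qed (use assms in auto)
  also have "(\<integral>\<^sup>+ y. ennreal ((t - y) ^ m) * indicator {0..t} y \<partial>lborel) =
      ennreal (- ((t - t) ^ Suc m / Suc m) - - ((t - 0) ^ Suc m / Suc m))"
  proof (rule nn_integral_FTC_Icc)
    show "((\<lambda>y. - ((t - y) ^ Suc m / Suc m)) has_real_derivative (t - y) ^ m) (at y)" for y
      by (rule derivative_eq_intros refl | simp del: of_nat_Suc power_Suc)+
  qed (use assms in auto)
  finally show ?thesis
    using assms by (simp del: of_nat_Suc add: ennreal_plus[symmetric] del: ennreal_plus)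
qed

text \<open>Cavalieri's principle: fixing coordinate \<open>b\<close> at \<open>y\<close> leaves a
  cross-polytope of radius \<open>t - \<bar>y\<bar>\<close> in one dimension less. Hence the
  induction needs all radii \<open>t\<close> at once.\<close>

lemma emeasure_cross_polytope:
  fixes A :: "'i set"
  assumes "finite A" "0 \<le> (t::real)"
  shows "emeasure (Pi\<^sub>M A (\<lambda>_. lborel))
      {x \<in> space (Pi\<^sub>M A (\<lambda>_. lborel)). (\<Sum>i\<in>A. \<bar>x i\<bar>) \<le> t}
    = ennreal ((2 * t) ^ card A / fact (card A))"
  using assms
proof (induction arbitrary: t rule: finite_induct)
  case (empty t)
  thus ?case by (simp add: PiM_empty)
next
  case (insert b A t)
  interpret product_sigma_finite "\<lambda>_. lborel :: real measure"
    by standard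
  let ?M = "\<lambda>A. Pi\<^sub>M A (\<lambda>_::'i. lborel :: real measure)"
  define S where "S = (\<lambda>A t. {x \<in> space (?M A). (\<Sum>i\<in>A. \<bar>x i\<bar>) \<le> t})"
  define m where "m = card A"
  have S_meas: "S A t \<in> sets (?M A)" if "finite A" for A t
    unfolding S_def using that by measurable
  note meas[measurable] = S_meas[OF \<open>finite A\<close>] S_meas[OF finite.insertI[OF \<open>finite A\<close>]]
  \<comment> \<open>The slice is empty for \<open>y\<close> outside \<open>{-t..t}\<close>.
    Recording this leaves only nonnegative radii, to which the induction hypothesis applies.\<close>
  have step: "x(b := y) \<in> S (insert b A) t \<longleftrightarrow> y \<in> {-t..t} \<and> x \<in> S A (t - \<bar>y\<bar>)"
    if "x \<in> space (?M A)" for x y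
  proof -
    have "(\<Sum>i\<in>A. \<bar>(x(b := y)) i\<bar>) = (\<Sum>i\<in>A. \<bar>x i\<bar>)"
      using insert.hyps by (intro sum.cong) auto
    moreover have "\<bar>y\<bar> \<le> t" if "\<bar>y\<bar> + (\<Sum>i\<in>A. \<bar>x i\<bar>) \<le> t"
      using that sum_abs_ge_zero[of x A] by linarith
    moreover have "x(b := y) \<in> space (?M (insert b A))"
      using that by (auto simp: space_PiM PiE_def extensional_def)
    ultimately show ?thesis
      using insert.hyps that by (auto simp: S_def abs_le_iff)
  qed
  have "emeasure (?M (insert b A)) (S (insert b A) t) =
      (\<integral>\<^sup>+ x. indicator (S (insert b A) t) x \<partial>?M (insert b A))"
    by simp
  also have "\<dots> = (\<integral>\<^sup>+ y. \<integral>\<^sup>+ x. indicator (S (insert b A) t) (x(b := y)) \<partial>?M A \<partial>lborel)"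
    using insert.hyps by (intro product_nn_integral_insert_rev) auto
  also have "\<dots> = (\<integral>\<^sup>+ y. \<integral>\<^sup>+ x. indicator (S A (t - \<bar>y\<bar>)) x * indicator {-t..t} y \<partial>?M A \<partial>lborel)"
    using step by (intro nn_integral_cong) (auto simp: indicator_def)
  also have "\<dots> = (\<integral>\<^sup>+ y. emeasure (?M A) (S A (t - \<bar>y\<bar>)) * indicator {-t..t} y \<partial>lborel)"
    by (simp add: nn_integral_multc)
  also have "\<dots> = (\<integral>\<^sup>+ y. ennreal (2 ^ m / fact m) *
      (ennreal ((t - \<bar>y\<bar>) ^ m) * indicator {-t..t} y) \<partial>lborel)"
    using insert.IH
    by (intro nn_integral_cong)
       (auto simp: indicator_def S_def m_def power_mult_distrib ennreal_mult[symmetric])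
  also have "\<dots> = ennreal (2 ^ m / fact m) * ennreal (2 * t ^ Suc m / Suc m)"
    using insert.prems by (subst nn_integral_cmult) (auto simp: nn_integral_diff_abs_power)
  also have "\<dots> = ennreal ((2 * t) ^ Suc m / fact (Suc m))"
    using insert.prems
    by (subst ennreal_mult[symmetric]) (auto simp: power_mult_distrib field_simps)
  finally show ?case
    using insert.hyps by (simp add: S_def m_def)
qed

section \<open>Projections onto finite spans and Bessel's inequality\<close>

text \<open>One Gram-Schmidt step per generator: \<open>u\<close> is the part of the new generator
  orthogonal to the old span, and the projection of \<open>x\<close> gains its component along
  \<open>u\<close>.\<close>

lemma exists_orthogonal_projection_span:
  fixes x :: "'a::real_inner"
  assumes "finite S"
  shows "\<exists>y\<in>span S. \<forall>z\<in>span S. orthogonal (x - y) z"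
  using assms
proof (induction S arbitrary: x rule: finite_induct)
  case empty
  show ?case by (auto simp: orthogonal_def)
next
  case (insert a S x)
  obtain p where p: "p \<in> span S" "\<And>z. z \<in> span S \<Longrightarrow> orthogonal (a - p) z"
    using insert.IH by blast
  obtain q where q: "q \<in> span S" "\<And>z. z \<in> span S \<Longrightarrow> orthogonal (x - q) z"
    using insert.IH by blast
  define u where "u = a - p"
  \<comment> \<open>If \<open>a\<close> already lies in \<open>span S\<close>, then
    \<open>u = 0\<close>, the quotient is 0 by the convention for division, and
    \<open>y = q\<close>.\<close>
  define y where "y = q + (x \<bullet> u / (u \<bullet> u)) *\<^sub>R u"
  have sub: "z \<in> span (insert a S)" if "z \<in> span S" for z
    using that span_mono[of S "insert a S"] by auto
  have "u \<in> span (insert a S)"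
    unfolding u_def by (intro span_diff sub[OF p(1)] span_base) auto
  hence "y \<in> span (insert a S)"
    unfolding y_def by (intro span_add span_scale sub[OF q(1)])
  moreover have orth: "orthogonal (x - y) z" if "z \<in> insert a S" for z
  proof -
    have S: "orthogonal (x - y) z" if "z \<in> span S" for z
      using p(2)[OF that] q(2)[OF that]
      by (simp add: y_def u_def orthogonal_def inner_diff_left inner_add_left algebra_simps)
    have "q \<bullet> u = 0"
      using p(2)[OF q(1)] by (simp add: u_def orthogonal_def inner_commute)
    hence "orthogonal (x - y) u"
      by (cases "u = 0") (auto simp: y_def orthogonal_def inner_diff_left inner_add_left)
    hence "orthogonal (x - y) (u + p)"
      using S[OF p(1)] by (simp add: orthogonal_def inner_add_right)
    thus ?thesis using that S[OF span_base] by (auto simp: u_def)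
  qed
  moreover have "orthogonal (x - y) z" if "z \<in> span (insert a S)" for z
    using that orth by (rule orthogonal_to_span)
  ultimately show ?case by blast
qed

text \<open>Used to pass from a ball of \<open>X\<close> to coordinates: whatever the dimension of
  \<open>X\<close>, the coordinate vector lies in a Euclidean ball of the same radius.\<close>

lemma bessel_inequality:
  fixes e :: "'i \<Rightarrow> 'a::real_inner"
  assumes "finite I" and "\<And>i j. i \<in> I \<Longrightarrow> j \<in> I \<Longrightarrow> e i \<bullet> e j = (if i = j then 1 else 0)"
  shows "(\<Sum>i\<in>I. (e i \<bullet> w)\<^sup>2) \<le> (norm w)\<^sup>2"
proof -
  define p where "p = (\<Sum>i\<in>I. (e i \<bullet> w) *\<^sub>R e i)"
  have "w \<bullet> p = (\<Sum>i\<in>I. (e i \<bullet> w)\<^sup>2)"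
    by (simp add: p_def inner_sum_right power2_eq_square inner_commute)
  moreover have "p \<bullet> p = (\<Sum>i\<in>I. (e i \<bullet> w)\<^sup>2)"
  proof -
    have "p \<bullet> p = (\<Sum>i\<in>I. \<Sum>j\<in>I. (e i \<bullet> w) * (e j \<bullet> w) * (e i \<bullet> e j))"
      by (simp add: p_def inner_sum_left inner_sum_right sum_distrib_left mult_ac inner_commute)
    also have "\<dots> = (\<Sum>i\<in>I. \<Sum>j\<in>I. if i = j then (e i \<bullet> w)\<^sup>2 else 0)"
      using assms(2) by (intro sum.cong refl) (auto simp: power2_eq_square)
    finally show ?thesis using assms(1) by simp
  qed
  moreover have "0 \<le> (w - p) \<bullet> (w - p)" by simp
  ultimately show ?thesis
    by (simp add: inner_diff_left inner_diff_right inner_commute power2_norm_eq_inner)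
qed

section \<open>Greedy spaces, decreasing errors and Gram-Schmidt\<close>

lemma greedy_space_mono: "m \<le> n \<Longrightarrow> greedy_space f m \<subseteq> greedy_space f n"
  unfolding greedy_space_def by (intro span_mono image_mono) auto

lemma zero_in_greedy_space [simp]: "0 \<in> greedy_space f n"
  by (simp add: greedy_space_def span_zero)

text \<open>Suprema of reals can be compared only for sets bounded above; here the norm bounds the
  distance because every greedy space contains 0.\<close>

lemma bdd_above_infdist_greedy_space:
  assumes "bounded K"
  shows "bdd_above ((\<lambda>g. infdist g (greedy_space f n)) ` K)"
proof -
  obtain B where "\<And>g. g \<in> K \<Longrightarrow> norm g \<le> B" using assms by (auto simp: bounded_iff)
  moreover have "infdist g (greedy_space f n) \<le> norm g" for g
    using infdist_le[OF zero_in_greedy_space, of g] by simp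
  ultimately show ?thesis by (meson bdd_above.I2 order_trans)
qed

lemma greedy_error_antimono:
  assumes "bounded K" "m \<le> n"
  shows "greedy_error K f n \<le> greedy_error K f m"
proof (cases "K = {}")
  case False
  then show ?thesis
    unfolding greedy_error_def
    by (intro cSUP_mono bdd_above_infdist_greedy_space assms(1))
       (metis assms(2) empty_iff greedy_space_mono infdist_mono zero_in_greedy_space)+
qed (simp add: greedy_error_def)

text \<open>The vectors are the normalized Gram-Schmidt residuals of the selections. A positive
  error after \<open>n\<close> steps keeps the first \<open>n\<close> residuals away from zero, so
  the normalization is legitimate.\<close>

lemma weak_greedy_orthonormal:
  fixes f :: "nat \<Rightarrow> 'a::real_inner"
  assumes "bounded K" and "0 < \<gamma>" and "weak_greedy \<gamma> K f" and "0 < greedy_error K f n"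
  obtains e where
    "\<And>i j. i \<in> {1..n} \<Longrightarrow> j \<in> {1..n} \<Longrightarrow> e i \<bullet> e j = (if i = j then 1 else 0)"
    "\<And>j k. j \<in> {1..n} \<Longrightarrow> k \<in> {1..n} \<Longrightarrow> k < j \<Longrightarrow> e j \<bullet> f k = 0"
    "\<And>j. j \<in> {1..n} \<Longrightarrow> \<gamma> * greedy_error K f n \<le> e j \<bullet> f j"
proof -
  have "\<exists>y. y \<in> greedy_space f (k - 1) \<and> (\<forall>z\<in>greedy_space f (k - 1). orthogonal (f k - y) z)" for k
    unfolding greedy_space_def
    using exists_orthogonal_projection_span[of "f ` {1..k - 1}" "f k"] by auto
  then obtain y where y: "\<And>k. y k \<in> greedy_space f (k - 1)"
    and orth: "\<And>k z. z \<in> greedy_space f (k - 1) \<Longrightarrow> (f k - y k) \<bullet> z = 0"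
    unfolding orthogonal_def by metis
  define u where "u = (\<lambda>k. f k - y k)"
  define e where "e = (\<lambda>k. u k /\<^sub>R norm (u k))"
  have norm_u: "\<gamma> * greedy_error K f n \<le> norm (u k)" if "k \<in> {1..n}" for k
  proof -
    \<comment> \<open>The selection rule at step \<open>k\<close> speaks of the error at
      \<open>k - 1\<close>. Monotonicity replaces it by the error at \<open>n\<close>, a bound
      uniform in \<open>k\<close>.\<close>
    have "\<gamma> * greedy_error K f n \<le> \<gamma> * greedy_error K f (k - 1)"
      using that assms(1,2) by (intro mult_left_mono greedy_error_antimono) auto
    also have "\<dots> \<le> infdist (f k) (greedy_space f (k - 1))"
      using assms(3) that by (auto simp: weak_greedy_def greedy_error_def)
    also have "\<dots> \<le> norm (u k)"
      using infdist_le[OF y, of "f k" k] by (simp add: u_def dist_norm)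
    finally show ?thesis .
  qed
  have u_nz: "u k \<noteq> 0" if "k \<in> {1..n}" for k
    using norm_u[OF that] mult_pos_pos[OF assms(2,4)] by auto
  have f_in: "f k \<in> greedy_space f m" if "1 \<le> k" "k \<le> m" for k m
    unfolding greedy_space_def using that by (intro span_base) auto
  have e_in: "e k \<in> greedy_space f m" if "1 \<le> k" "k \<le> m" for k m
  proof -
    have "y k \<in> greedy_space f m"
      using y[of k] greedy_space_mono[of "k - 1" m f] that by (simp add: subset_iff)
    thus ?thesis
      using f_in[OF that] unfolding e_def u_def greedy_space_def by (intro span_scale span_diff)
  qed
  have e_orth: "e k \<bullet> z = 0" if "z \<in> greedy_space f (k - 1)" for k z
    using orth[OF that] by (simp add: e_def u_def)
  show thesis
  proof (rule that)
    fix i j assume ij: "i \<in> {1..n}" "j \<in> {1..n}"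
    show "e i \<bullet> e j = (if i = j then 1 else 0)"
    proof (rule linorder_cases[of i j])
      assume "i = j"
      thus ?thesis using u_nz[OF ij(1)]
        by (simp add: e_def dot_square_norm power2_eq_square)
    next
      assume "i < j"
      thus ?thesis using e_orth[OF e_in, of i j] ij by (simp add: inner_commute)
    next
      assume "j < i"
      thus ?thesis using e_orth[OF e_in, of j i] ij by simp
    qed
  next
    fix j k assume "j \<in> {1..n}" "k \<in> {1..n}" "k < j"
    thus "e j \<bullet> f k = 0" by (intro e_orth f_in) auto
  next
    fix j assume j: "j \<in> {1..n}"
    \<comment> \<open>\<open>u j\<close> is orthogonal to \<open>y j\<close>, so its inner product
      with \<open>f j\<close> is its squared norm; after normalization the diagonal entry is the
      residual norm.\<close>
    have "u j \<bullet> u j = u j \<bullet> f j" using orth[OF y, of j] by (simp add: u_def inner_diff_right)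
    hence "e j \<bullet> f j = norm (u j)"
      using u_nz[OF j] by (simp add: e_def dot_square_norm power2_eq_square flip: \<open>u j \<bullet> u j = u j \<bullet> f j\<close>)
    thus "\<gamma> * greedy_error K f n \<le> e j \<bullet> f j" using norm_u[OF j] by simp
  qed
qed

section \<open>Ellipsoids in parameter space, the symmetric hull and its covers\<close>

text \<open>The ellipsoid is the preimage of a centred Euclidean ball under a triangular affine map,
  so the change of variables applies to the indicator of the ball. The determinant stands as a
  factor, which avoids division in \<open>ennreal\<close>.\<close>

lemma emeasure_triangular_ellipsoid:
  fixes a :: "'i::linorder \<Rightarrow> 'i \<Rightarrow> real"
  assumes "finite I" and "0 < r"
    and "\<And>j. j \<in> I \<Longrightarrow> a j j \<noteq> 0"
    and "\<And>j k. j \<in> I \<Longrightarrow> k \<in> I \<Longrightarrow> k < j \<Longrightarrow> a j k = 0"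
  shows "ennreal (\<Prod>j\<in>I. \<bar>a j j\<bar>) * emeasure (Pi\<^sub>M I (\<lambda>_. lborel))
      {x \<in> space (Pi\<^sub>M I (\<lambda>_. lborel)). (\<Sum>j\<in>I. (v j + (\<Sum>k\<in>I. a j k * x k))\<^sup>2) \<le> r\<^sup>2}
    = ennreal (unit_ball_vol (card I) * r ^ card I)"
proof -
  let ?M = "Pi\<^sub>M I (\<lambda>_. lborel :: real measure)"
  define T where "T = (\<lambda>x. \<lambda>j\<in>I. v j + (\<Sum>k\<in>I. a j k * x k))"
  define B where "B = {z \<in> space ?M. (\<Sum>j\<in>I. (z j)\<^sup>2) \<le> r\<^sup>2}"
  define E where "E = {x \<in> space ?M. (\<Sum>j\<in>I. (v j + (\<Sum>k\<in>I. a j k * x k))\<^sup>2) \<le> r\<^sup>2}"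
  have [measurable]: "B \<in> sets ?M" "E \<in> sets ?M"
    unfolding B_def E_def using assms(1) by measurable
  have ind: "indicator B (T x) = (indicator E x :: ennreal)" if "x \<in> space ?M" for x
    using that by (auto simp: B_def E_def T_def indicator_def space_PiM)
  have "ennreal (\<Prod>j\<in>I. \<bar>a j j\<bar>) * emeasure ?M E =
      ennreal (\<Prod>j\<in>I. \<bar>a j j\<bar>) * (\<integral>\<^sup>+ x. indicator B (T x) \<partial>?M)"
    by (simp add: ind cong: nn_integral_cong_simp)
  also have "\<dots> = (\<integral>\<^sup>+ x. indicator B x \<partial>?M)"
    unfolding T_def using assms
    by (intro nn_integral_PiM_lborel_triangular_affine[symmetric]) auto
  also have "\<dots> = emeasure ?M B" by simp
  also have "B = {z. sqrt (\<Sum>j\<in>I. (z j)\<^sup>2) \<le> r} \<inter> space ?M"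
    using assms(2) by (auto simp: B_def real_sqrt_le_iff' sum_nonneg)
  also have "emeasure ?M \<dots> = ennreal (unit_ball_vol (card I) * r ^ card I)"
    using assms(1,2) by (rule emeasure_cball_aux)
  finally show ?thesis unfolding E_def .
qed

lemma sum_scale_in_sym_convex_hull:
  fixes f :: "nat \<Rightarrow> 'a::real_normed_vector"
  assumes "\<And>k. k \<in> {1..n} \<Longrightarrow> f k \<in> K" and "(\<Sum>k\<in>{1..n}. \<bar>x k\<bar>) \<le> 1"
  shows "(\<Sum>k\<in>{1..n}. x k *\<^sub>R f k) \<in> sym_convex_hull K"
proof -
  \<comment> \<open>Selections are numbered from 1, the sums in \<open>sym_convex_hull\<close> from
    0.\<close>
  have "(\<Sum>i<n. \<bar>x (Suc i)\<bar>) \<le> 1" "\<forall>i<n. f (Suc i) \<in> K"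
    using assms by (auto simp: sum.atLeast1_atMost_eq)
  moreover have "(\<Sum>k\<in>{1..n}. x k *\<^sub>R f k) = (\<Sum>i<n. x (Suc i) *\<^sub>R f (Suc i))"
    by (simp add: sum.atLeast1_atMost_eq)
  ultimately show ?thesis
    unfolding sym_convex_hull_def
    by (intro subsetD[OF closure_subset] CollectI exI[of _ n] exI[of _ "\<lambda>i. x (Suc i)"]
        exI[of _ "\<lambda>i. f (Suc i)"]) auto
qed

lemma bounded_sym_convex_hull:
  assumes "bounded K"
  shows "bounded (sym_convex_hull K)"
proof -
  obtain B where B: "0 < B" "\<And>g. g \<in> K \<Longrightarrow> norm g \<le> B"
    using assms by (auto simp: bounded_pos)
  have "norm (\<Sum>i<m. c i *\<^sub>R g i) \<le> B"
    if "(\<Sum>i<m. \<bar>c i\<bar>) \<le> 1" "\<forall>i<m. g i \<in> K" for m :: nat and c :: "nat \<Rightarrow> real" and g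
  proof -
    have "norm (\<Sum>i<m. c i *\<^sub>R g i) \<le> (\<Sum>i<m. \<bar>c i\<bar> * B)"
      using that B by (intro sum_norm_le) (auto intro: mult_left_mono)
    also have "\<dots> \<le> 1 * B"
      unfolding sum_distrib_right[symmetric] using that B by (intro mult_right_mono) auto
    finally show ?thesis by simp
  qed
  thus ?thesis
    unfolding sym_convex_hull_def by (intro bounded_closure boundedI[of _ B]) blast
qed

text \<open>One ball repeated \<open>2 ^ n\<close> times suffices, with \<open>max r 1\<close> to
  make its radius positive. It guarantees that the infimum in \<open>entropy_number\<close> is over
  a nonempty set.\<close>

lemma bounded_ex_cball_cover:
  fixes A :: "'a::metric_space set"
  assumes "bounded A"
  shows "\<exists>\<epsilon>. \<epsilon> > 0 \<and> (\<exists>c::nat \<Rightarrow> 'a. A \<subseteq> (\<Union>i<2 ^ n. cball (c i) \<epsilon>))"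
proof -
  obtain x r where "A \<subseteq> cball x r" using assms by (auto simp: bounded_subset_cball)
  hence "A \<subseteq> (\<Union>i<(2 :: nat) ^ n. cball x (max r 1))"
    by (auto simp: lessThan_empty_iff)
  thus ?thesis by (intro exI[of _ "max r 1"] conjI exI[of _ "\<lambda>_. x"]) auto
qed

section \<open>Volume comparison and passage to the entropy number\<close>

lemma weak_greedy_error_cover_bound:
  fixes K :: "'a::real_inner set" and c :: "nat \<Rightarrow> 'a"
  assumes "bounded K" and "0 < \<gamma>" and "weak_greedy \<gamma> K f" and "0 < greedy_error K f n"
    and "0 < \<epsilon>" and cover: "sym_convex_hull K \<subseteq> (\<Union>i<2 ^ n. cball (c i) \<epsilon>)"
  shows "(\<gamma> * greedy_error K f n) ^ n \<le> fact n * unit_ball_vol (real n) * \<epsilon> ^ n"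
proof -
  obtain e where
    on: "\<And>i j. i \<in> {1..n} \<Longrightarrow> j \<in> {1..n} \<Longrightarrow> e i \<bullet> e j = (if i = j then 1 else 0)" and
    tri: "\<And>j k. j \<in> {1..n} \<Longrightarrow> k \<in> {1..n} \<Longrightarrow> k < j \<Longrightarrow> e j \<bullet> f k = 0" and
    diag: "\<And>j. j \<in> {1..n} \<Longrightarrow> \<gamma> * greedy_error K f n \<le> e j \<bullet> f j"
    using weak_greedy_orthonormal[OF assms(1-4)] by blast
  have pos: "0 < \<gamma> * greedy_error K f n" using assms by simp
  let ?M = "Pi\<^sub>M {1..n} (\<lambda>_. lborel :: real measure)"
  define p where "p = (\<lambda>x. \<Sum>k\<in>{1..n}. x k *\<^sub>R f k)"
  define C where "C = {x \<in> space ?M. (\<Sum>k\<in>{1..n}. \<bar>x k\<bar>) \<le> 1}"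
  \<comment> \<open>Coefficients \<open>x\<close> for which the coordinates of
    \<open>p x - c i\<close> have Euclidean norm at most \<epsilon>. The centre \<open>c i\<close>
    may lie outside the span of the selections; only its coordinates enter, as a
    translation.\<close>
  define E where "E = (\<lambda>i. {x \<in> space ?M.
    (\<Sum>j\<in>{1..n}. (- (e j \<bullet> c i) + (\<Sum>k\<in>{1..n}. (e j \<bullet> f k) * x k))\<^sup>2) \<le> \<epsilon>\<^sup>2})"
  \<comment> \<open>The absolute determinant of the triangular matrix with entries
    \<open>e j \<bullet> f k\<close>.\<close>
  define D where "D = (\<Prod>j\<in>{1..n}. \<bar>e j \<bullet> f j\<bar>)"
  have E_sets: "E i \<in> sets ?M" for i unfolding E_def by measurable
  have vol_E: "ennreal D * emeasure ?M (E i) = ennreal (unit_ball_vol (real n) * \<epsilon> ^ n)" for i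
  proof -
    have "e j \<bullet> f j \<noteq> 0" if "j \<in> {1..n}" for j using diag[OF that] pos by auto
    thus ?thesis
      using emeasure_triangular_ellipsoid[of "{1..n}" \<epsilon> "\<lambda>j k. e j \<bullet> f k" "\<lambda>j. - (e j \<bullet> c i)"]
        assms(5) tri by (simp add: E_def D_def)
  qed
  have "C \<subseteq> (\<Union>i<2 ^ n. E i)"
  proof
    fix x assume x: "x \<in> C"
    have "f k \<in> K" if "k \<in> {1..n}" for k using assms(3) that by (auto simp: weak_greedy_def)
    hence "p x \<in> sym_convex_hull K"
      unfolding p_def using x by (intro sum_scale_in_sym_convex_hull) (auto simp: C_def)
    then obtain i where i: "i < 2 ^ n" "norm (p x - c i) \<le> \<epsilon>"
      using cover by (auto simp: dist_norm norm_minus_commute)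
    have "- (e j \<bullet> c i) + (\<Sum>k\<in>{1..n}. (e j \<bullet> f k) * x k) = e j \<bullet> (p x - c i)" for j
      by (simp add: p_def inner_diff_right inner_sum_right mult.commute)
    hence "(\<Sum>j\<in>{1..n}. (- (e j \<bullet> c i) + (\<Sum>k\<in>{1..n}. (e j \<bullet> f k) * x k))\<^sup>2)
        \<le> (norm (p x - c i))\<^sup>2"
      using bessel_inequality[of "{1..n}" e "p x - c i"] on by simp
    also have "\<dots> \<le> \<epsilon>\<^sup>2" using i(2) by (intro power_mono) auto
    finally show "x \<in> (\<Union>i<2 ^ n. E i)" using x i(1) by (auto simp: E_def C_def)
  qed
  hence "emeasure ?M C \<le> emeasure ?M (\<Union>i<2 ^ n. E i)"
    using E_sets by (intro emeasure_mono) auto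
  also have "\<dots> \<le> (\<Sum>i<2 ^ n. emeasure ?M (E i))"
    using E_sets by (intro emeasure_subadditive_finite) auto
  \<comment> \<open>Multiplied by \<open>D\<close>, all ellipsoids have the same volume, that of a
    Euclidean ball of radius \<epsilon>, independent of the centre.\<close>
  finally have "ennreal D * emeasure ?M C \<le> ennreal D * (\<Sum>i<2 ^ n. emeasure ?M (E i))"
    by (intro mult_left_mono) auto
  also have "\<dots> = ennreal (2 ^ n * (unit_ball_vol (real n) * \<epsilon> ^ n))"
    using assms(5) unfolding sum_distrib_left vol_E by (simp add: ennreal_mult flip: ennreal_power)
  finally have "ennreal D * emeasure ?M C \<le> \<dots>" .
  moreover have "emeasure ?M C = ennreal (2 ^ n / fact n)"
    unfolding C_def using emeasure_cross_polytope[of "{1..n}" 1] by simp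
  moreover have "0 \<le> D" unfolding D_def by (intro prod_nonneg) auto
  ultimately have "D * (2 ^ n / fact n) \<le> 2 ^ n * (unit_ball_vol (real n) * \<epsilon> ^ n)"
    using assms(5) by (simp add: ennreal_le_iff flip: ennreal_mult)
  \<comment> \<open>The factor \<open>2 ^ n\<close> of the cross-polytope volume cancels against the
    number of balls.\<close>
  hence "D \<le> fact n * unit_ball_vol (real n) * \<epsilon> ^ n"
    by (simp add: field_simps)
  moreover have "(\<gamma> * greedy_error K f n) ^ n \<le> D"
  proof -
    have "(\<Prod>j\<in>{1..n}. \<gamma> * greedy_error K f n) \<le> D"
      unfolding D_def using diag pos by (intro prod_mono) force
    thus ?thesis by simp
  qed
  ultimately show ?thesis by linarith
qed

theorem theorem2p1:
  fixes K :: "'a::{real_inner, complete_space} set"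
    and f :: "nat \<Rightarrow> 'a" and \<gamma> :: real and n :: nat
  assumes "compact K" and "K \<noteq> {}"
    and "0 < \<gamma>" and "\<gamma> \<le> 1"
    and "weak_greedy \<gamma> K f"
    and "n \<ge> 1"
  shows "greedy_error K f n
    \<le> inverse \<gamma> * (fact n * unit_ball_vol (real n)) powr (1 / real n)
        * entropy_number n (sym_convex_hull K)"
proof -
  define V where "V = fact n * unit_ball_vol (real n)"
  define R where "R = {\<epsilon>. \<epsilon> > 0 \<and>
    (\<exists>c::nat \<Rightarrow> 'a. sym_convex_hull K \<subseteq> (\<Union>i<2 ^ n. cball (c i) \<epsilon>))}"
  have bdd: "bounded K" using assms(1) by (rule compact_imp_bounded)
  have R_ne: "R \<noteq> {}"
    using bounded_ex_cball_cover[OF bounded_sym_convex_hull[OF bdd]] by (auto simp: R_def)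
  have V_pos: "0 < V" by (simp add: V_def)
  \<comment> \<open>A lower bound for every admissible radius passes to the infimum, whether or not
    it is attained.\<close>
  have "\<gamma> * greedy_error K f n / V powr (1 / n) \<le> Inf R"
  proof (rule cInf_greatest[OF R_ne])
    fix \<epsilon> assume "\<epsilon> \<in> R"
    then obtain c :: "nat \<Rightarrow> 'a" where \<epsilon>: "0 < \<epsilon>"
      and c: "sym_convex_hull K \<subseteq> (\<Union>i<2 ^ n. cball (c i) \<epsilon>)"
      by (auto simp: R_def)
    show "\<gamma> * greedy_error K f n / V powr (1 / n) \<le> \<epsilon>"
    proof (cases "0 < greedy_error K f n")
      case True
      have "(\<gamma> * greedy_error K f n) ^ n \<le> V * \<epsilon> ^ n"
        unfolding V_def
        using weak_greedy_error_cover_bound[OF bdd \<open>0 < \<gamma>\<close> assms(5) True \<epsilon> c] .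
      \<comment> \<open>Writing the right side as an \<open>n\<close>-th power lets the root be
        taken; this uses \<open>n \<ge> 1\<close> and the positivity of the constant.\<close>
      also have "\<dots> = (V powr (1 / n) * \<epsilon>) ^ n"
        using V_pos \<open>n \<ge> 1\<close> by (simp add: power_mult_distrib powr_power)
      finally have "\<gamma> * greedy_error K f n \<le> V powr (1 / n) * \<epsilon>"
        using \<epsilon> \<open>n \<ge> 1\<close> by (subst (asm) power_mono_iff) (use True assms(3) in auto)
      thus ?thesis using V_pos by (simp add: field_simps)
    next
      case False
      hence "\<gamma> * greedy_error K f n / V powr (1 / n) \<le> 0"
        using assms(3) by (intro divide_nonpos_nonneg mult_nonneg_nonpos) auto
      thus ?thesis using \<epsilon> by linarith
    qed
  qed
  thus ?thesis
    using assms(3) V_pos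
    by (simp add: entropy_number_def R_def[symmetric] V_def[symmetric] field_simps)
qed

end
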